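(* For $q>1$ and $|u|<1$, $$\sum_{n\ge 0} u^nq^{n^2} \left( \sum_{\substack{0\le r\le n\\ r \text{ even}}} \frac{1}{A_r} +\sum_{\substack{1\le r\le n\\ r \text{ even}}} \frac{1}{B_r}+ \sum_{\substack{1\le r\le n\\ r \text{ odd}}} \frac{1}{C_r} \right)= \frac{1}{1-u}\, \frac{\prod_{i \geq 1} (1+u/q^{2i})}{\prod_{i \geq 1} (1-u^2/q^{2i})},$$ where (depending on $n$) $$A_r= q^{r(r+1)/2+r(2n-2r)}\,|Sp(r,q)|\,|Sp(2n-2r,q)|,$$ $$B_r= q^{r(r+1)/2+r(2n-2r)}\,q^{r-1}\,|Sp(r-2,q)|\,|Sp(2n-2r,q)|,$$ $$C_r= q^{r(r+1)/2+r(2n-2r)}\,|Sp(r-1,q)|\,|Sp(2n-2r,q)|.$$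
   Context: Here $q$ is a real number, $u$ is a complex number, and $|Sp(2m,q)|$ denotes the expression $|Sp(2m,q)|=q^{m^2}\prod_{i=1}^m (q^{2i}-1)$ for $m\ge 0$ (so $|Sp(0,q)|=1$), which for a prime power $q$ is the order of the symplectic group. *)

theory Defs
  imports "HOL-Analysis.Analysis"
begin

text \<open>
  \<open>Sp_order d q\<close> is the expression $|Sp(d,q)|$, indexed by the dimension \<open>d = 2m\<close> and taken at a
  real \<open>q\<close>. It is meaningful only for even \<open>d\<close>.
\<close>

definition Sp_order :: "nat \<Rightarrow> real \<Rightarrow> real" where
  "Sp_order d q = (let m = d div 2 in q ^ (m\<^sup>2) * (\<Prod>i=1..m. (q ^ (2 * i) - 1)))"

text \<open>
  In the following, \<open>r \<le> n\<close>, so the truncated subtraction \<open>2 * n - 2 * r\<close> is exact; \<open>B_r\<close> is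
  used only for even \<open>r \<ge> 2\<close> and \<open>C_r\<close> only for odd \<open>r\<close>, so \<open>r - 1\<close> and \<open>r - 2\<close> are exact as well.
\<close>

definition A_r :: "real \<Rightarrow> nat \<Rightarrow> nat \<Rightarrow> real" where
  "A_r q n r = q ^ (r * (r + 1) div 2 + r * (2 * n - 2 * r)) * Sp_order r q * Sp_order (2 * n - 2 * r) q"

definition B_r :: "real \<Rightarrow> nat \<Rightarrow> nat \<Rightarrow> real" where
  "B_r q n r = q ^ (r * (r + 1) div 2 + r * (2 * n - 2 * r)) * q ^ (r - 1)
     * Sp_order (r - 2) q * Sp_order (2 * n - 2 * r) q"

definition C_r :: "real \<Rightarrow> nat \<Rightarrow> nat \<Rightarrow> real" where
  "C_r q n r = q ^ (r * (r + 1) div 2 + r * (2 * n - 2 * r))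
     * Sp_order (r - 1) q * Sp_order (2 * n - 2 * r) q"

end

theory Submission imports Defs begin

text \<open>
  Put \<open>x = 1 / q\<^sup>2\<close>, so that \<open>|Sp(2m,q)| = q^(2m\<^sup>2+m) (x;x)\<^sub>m\<close>. For \<open>r + k = n\<close>, collecting powers
  of \<open>q\<close> shows that the terms with index \<open>r\<close> contribute
  \<open>x^(k(k+1)/2) / ((x;x)\<^sub>s (x;x)\<^sub>k)\<close> with \<open>s = \<lfloor>r/2\<rfloor>\<close>; for even \<open>r\<close> this uses
  \<open>x^s / (x;x)\<^sub>s + 1 / (x;x)\<^sub>s\<^sub>-\<^sub>1 = 1 / (x;x)\<^sub>s\<close>. Hence the generating function is the product of
  \<open>\<Sum> u^r / (x;x)\<^sub>s = (1 + u) \<Sum> u^(2s) / (x;x)\<^sub>s\<close> and \<open>\<Sum> (u x)^k x^(k(k-1)/2) / (x;x)\<^sub>k\<close>, both of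
  which Euler's identities evaluate as infinite products.
\<close>

section \<open>The finite products \<open>(x;x)\<^sub>n\<close>\<close>

definition qfact :: "'a::comm_ring_1 \<Rightarrow> nat \<Rightarrow> 'a" where
  "qfact x n = (\<Prod>i=1..n. (1 - x ^ i))"

lemma qfact_0 [simp]: "qfact x 0 = 1"
  by (simp add: qfact_def)

lemma qfact_Suc: "qfact x (Suc n) = qfact x n * (1 - x ^ Suc n)"
  by (simp add: qfact_def)

text \<open>Links the coefficients, which are computed over the reals, with the complex series in
  \<open>u\<close>.\<close>

lemma qfact_of_real:
  "qfact (of_real x :: 'a::{real_algebra_1,comm_ring_1}) n = of_real (qfact x n)"
  by (simp add: qfact_def)

lemma one_minus_power_nonzero:
  fixes x :: "'a::real_normed_field"
  assumes "norm x < 1"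
  shows "1 - x ^ Suc n \<noteq> 0"
proof
  assume "1 - x ^ Suc n = 0"
  then have "norm (x ^ Suc n) = 1" by simp
  moreover have "norm x ^ Suc n < 1" using assms by (simp add: power_less_one_iff del: power_Suc)
  ultimately show False by (metis less_irrefl norm_power)
qed

lemma qfact_nonzero:
  fixes x :: "'a::real_normed_field"
  assumes "norm x < 1"
  shows "qfact x n \<noteq> 0"
  by (induction n) (use one_minus_power_nonzero[OF assms] in \<open>auto simp: qfact_Suc simp del: power_Suc\<close>)

section \<open>Convergence of Euler's series and products\<close>

lemma tendsto_one_minus_power:
  fixes x :: "'a::real_normed_field"
  assumes "norm x < 1"
  shows "(\<lambda>n. 1 - x ^ Suc n) \<longlonglongrightarrow> 1"
  using tendsto_diff[OF tendsto_const LIMSEQ_Suc[OF LIMSEQ_power_zero[OF assms]], of 1] by simp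

text \<open>The ratio test with a constant strictly between \<open>norm l\<close> and 1. The ratio
  enters as a factor \<open>r n\<close>, not as a quotient, so that vanishing terms, as for
  \<open>z = 0\<close>, do no harm.\<close>

lemma summable_norm_ratio_limit:
  fixes f :: "nat \<Rightarrow> 'a::real_normed_field"
  assumes "\<And>n. f (Suc n) = f n * r n" and "r \<longlonglongrightarrow> l" and "norm l < 1"
  shows "summable (\<lambda>n. norm (f n))"
proof -
  obtain c where c: "norm l < c" "c < 1" using assms(3) dense by blast
  have "(\<lambda>n. norm (r n)) \<longlonglongrightarrow> norm l" using assms(2) by (rule tendsto_norm)
  then have "\<forall>\<^sub>F n in sequentially. norm (r n) < c" using c(1) by (rule order_tendstoD)
  then obtain N where N: "\<And>n. n \<ge> N \<Longrightarrow> norm (r n) < c" by (auto simp: eventually_sequentially)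
  show ?thesis
  proof (rule summable_ratio_test[OF c(2)])
    fix n assume "N \<le> n"
    then have "norm (f n) * norm (r n) \<le> norm (f n) * c"
      by (intro mult_left_mono less_imp_le[OF N]) auto
    then show "norm (norm (f (Suc n))) \<le> c * norm (norm (f n))"
      by (simp add: assms(1) norm_mult mult.commute)
  qed
qed

lemma summable_norm_euler1:
  fixes x z :: "'a::real_normed_field"
  assumes x: "norm x < 1" and z: "norm z < 1"
  shows "summable (\<lambda>n. norm (z ^ n / qfact x n))"
proof (rule summable_norm_ratio_limit)
  show "z ^ Suc n / qfact x (Suc n) = z ^ n / qfact x n * (z / (1 - x ^ Suc n))" for n
    by (simp add: qfact_Suc)
  show "(\<lambda>n. z / (1 - x ^ Suc n)) \<longlonglongrightarrow> z"
    using tendsto_divide[OF tendsto_const tendsto_one_minus_power[OF x], of z] by simp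
qed (rule z)

lemma Suc_choose_two: "Suc n choose 2 = (n choose 2) + n"
  by (simp add: numeral_2_eq_2)

lemma summable_norm_euler2:
  fixes x z :: "'a::real_normed_field"
  assumes x: "norm x < 1"
  shows "summable (\<lambda>n. norm (x ^ (n choose 2) / qfact x n * z ^ n))"
proof (rule summable_norm_ratio_limit)
  show "x ^ (Suc n choose 2) / qfact x (Suc n) * z ^ Suc n
      = x ^ (n choose 2) / qfact x n * z ^ n * (x ^ n * z / (1 - x ^ Suc n))" for n
    by (simp add: qfact_Suc Suc_choose_two power_add)
  show "(\<lambda>n. x ^ n * z / (1 - x ^ Suc n)) \<longlonglongrightarrow> 0"
    using tendsto_divide[OF tendsto_mult[OF LIMSEQ_power_zero[OF x] tendsto_const]
        tendsto_one_minus_power[OF x], of z] by simp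
qed simp

text \<open>A power series is continuous at 0 once it converges at some nonzero point
  \<open>K\<close>, and \<open>x ^ N * z\<close> tends to 0. This supplies the limit when a
  functional equation relating \<open>y\<close> and \<open>x * y\<close> is iterated.\<close>

lemma powser_geometric_tendsto:
  fixes x z K :: "'a::{real_normed_field,banach}"
  assumes "norm x < 1" and "summable (\<lambda>n. c n * K ^ n)" and "K \<noteq> 0"
  shows "(\<lambda>N. \<Sum>n. c n * (x ^ N * z) ^ n) \<longlonglongrightarrow> c 0"
proof -
  have "isCont (\<lambda>y. \<Sum>n. c n * y ^ n) 0"
    by (rule isCont_powser[OF assms(2)]) (use assms(3) in auto)
  moreover have "(\<lambda>N. x ^ N * z) \<longlonglongrightarrow> 0"
    using tendsto_mult[OF LIMSEQ_power_zero[OF assms(1)] tendsto_const, of z] by simp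
  ultimately have "(\<lambda>N. \<Sum>n. c n * (x ^ N * z) ^ n) \<longlonglongrightarrow> (\<Sum>n. c n * 0 ^ n)"
    by (rule isCont_tendsto_compose)
  then show ?thesis by simp
qed

lemma convergent_prod_one_plus_geometric:
  fixes x z :: "'a::{real_normed_field,banach}"
  assumes "norm x < 1"
  shows "convergent_prod (\<lambda>i. 1 + z * x ^ i)"
proof -
  have "summable (\<lambda>i. norm (z * x ^ i))"
    using assms by (auto simp: norm_mult norm_power intro!: summable_mult summable_geometric)
  then show ?thesis
    by (intro abs_convergent_prod_imp_convergent_prod summable_imp_abs_convergent_prod) simp
qed

lemma prod_one_plus_geometric_tendsto:
  fixes x z :: "'a::{real_normed_field,banach}"
  assumes "norm x < 1"
  shows "(\<lambda>N. \<Prod>i<N. 1 + z * x ^ i) \<longlonglongrightarrow> (\<Prod>i. 1 + z * x ^ i)"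
  by (rule LIMSEQ_offset[of _ 1])
    (use convergent_prod_LIMSEQ[OF convergent_prod_one_plus_geometric[OF assms]]
      in \<open>simp add: lessThan_Suc_atMost\<close>)

text \<open>A convergent infinite product vanishes only if some factor does, and here
  \<open>norm (z * x ^ i) \<le> norm z < 1\<close>. It permits the division by the product in
  \<open>euler1\<close>.\<close>

lemma prodinf_one_minus_geometric_nonzero:
  fixes x z :: "'a::{real_normed_field,banach}"
  assumes "norm x < 1" and "norm z < 1"
  shows "(\<Prod>i. 1 - z * x ^ i) \<noteq> 0"
proof -
  have "1 - z * x ^ i \<noteq> 0" for i
  proof
    assume "1 - z * x ^ i = 0"
    then have "norm (z * x ^ i) = 1" by simp
    moreover have "norm z * norm x ^ i \<le> norm z * 1"
      using assms by (intro mult_left_mono power_le_one) auto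
    ultimately show False using assms(2) by (simp add: norm_mult norm_power)
  qed
  then show ?thesis
    using prodinf_nonzero[OF convergent_prod_one_plus_geometric[OF assms(1), of "- z"]] by simp
qed

section \<open>Euler's two identities\<close>

lemma euler1:
  fixes x z :: "'a::{real_normed_field,banach}"
  assumes x: "norm x < 1" and z: "norm z < 1"
  shows "(\<lambda>n. z ^ n / qfact x n) sums (1 / (\<Prod>i. 1 - z * x ^ i))"
proof -
  define F where "F y = (\<Sum>n. 1 / qfact x n * y ^ n)" for y
  have summ: "summable (\<lambda>n. 1 / qfact x n * y ^ n)" if "norm y < 1" for y
    using summable_norm_cancel[OF summable_norm_euler1[OF x that]] by simp
  have small: "norm (x ^ N * z) < 1" for N
  proof -
    have "norm x ^ N * norm z \<le> 1 * norm z"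
      using x by (intro mult_right_mono power_le_one) auto
    then show ?thesis using z by (simp add: norm_mult norm_power)
  qed
  \<comment> \<open>In \<open>F y - F (x * y)\<close> the constant terms cancel, and
    \<open>1 - x ^ Suc n\<close> removes the last factor of \<open>qfact x (Suc n)\<close>, which
    leaves \<open>y * F y\<close>. Iterating from \<open>z\<close> yields the partial products times
    \<open>F z\<close>.\<close>
  have step: "F (x * y) = (1 - y) * F y" if y: "norm y < 1" for y
  proof -
    have xy: "norm (x * y) < 1"
      using mult_strict_mono[OF x y] by (simp add: norm_mult)
    have "F y - F (x * y) = (\<Sum>n. 1 / qfact x n * y ^ n - 1 / qfact x n * (x * y) ^ n)"
      unfolding F_def by (rule suminf_diff[OF summ[OF y] summ[OF xy]])
    also have "\<dots> = (\<Sum>n. 1 / qfact x (Suc n) * y ^ Suc n - 1 / qfact x (Suc n) * (x * y) ^ Suc n)"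
      by (subst suminf_split_head[OF summable_diff[OF summ[OF y] summ[OF xy]]]) simp
    also have "\<dots> = (\<Sum>n. y * (1 / qfact x n * y ^ n))"
    proof (rule suminf_cong)
      fix n
      have "1 / qfact x (Suc n) * y ^ Suc n - 1 / qfact x (Suc n) * (x * y) ^ Suc n
          = y ^ Suc n * (1 - x ^ Suc n) / qfact x (Suc n)"
        by (simp add: field_simps diff_divide_distrib)
      also have "\<dots> = y * (1 / qfact x n * y ^ n)"
        using one_minus_power_nonzero[OF x, of n] unfolding qfact_Suc by simp
      finally show "1 / qfact x (Suc n) * y ^ Suc n - 1 / qfact x (Suc n) * (x * y) ^ Suc n
          = y * (1 / qfact x n * y ^ n)" .
    qed
    also have "\<dots> = y * F y"
      unfolding F_def by (rule suminf_mult[OF summ[OF y]])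
    finally show ?thesis by (simp add: algebra_simps)
  qed
  have iter: "F (x ^ N * z) = (\<Prod>i<N. 1 + (- z) * x ^ i) * F z" for N
  proof (induction N)
    case (Suc N)
    have "F (x ^ Suc N * z) = (1 - x ^ N * z) * F (x ^ N * z)"
      using step[OF small, of N] by (simp only: mult.assoc power_Suc)
    also have "\<dots> = (\<Prod>i<Suc N. 1 + (- z) * x ^ i) * F z"
      by (simp only: Suc) (simp add: mult_ac)
    finally show ?case .
  qed simp
  \<comment> \<open>The limit is the constant term of \<open>F\<close>; 1/2 serves as a nonzero
    point in the disc of convergence.\<close>
  have "(\<lambda>N. F (x ^ N * z)) \<longlonglongrightarrow> 1"
    unfolding F_def
    using powser_geometric_tendsto[OF x summ[of "of_real (1/2)"], of z] by simp
  moreover have "(\<lambda>N. F (x ^ N * z)) \<longlonglongrightarrow> (\<Prod>i. 1 + (- z) * x ^ i) * F z"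
    unfolding iter by (intro tendsto_mult tendsto_const prod_one_plus_geometric_tendsto x)
  ultimately have "(\<Prod>i. 1 - z * x ^ i) * F z = 1"
    using LIMSEQ_unique by fastforce
  then have "F z = 1 / (\<Prod>i. 1 - z * x ^ i)"
    using prodinf_one_minus_geometric_nonzero[OF x z] by (simp add: field_simps)
  then show ?thesis
    using summable_sums[OF summ[OF z]] by (simp add: F_def)
qed

text \<open>As for \<open>euler1\<close>, but the extra \<open>x ^ n\<close> from
  \<open>Suc n choose 2\<close> turns \<open>y ^ n\<close> into \<open>(x * y) ^ n\<close>. The
  difference \<open>G y - G (x * y)\<close> is therefore \<open>y * G (x * y)\<close>, and the
  product appears in the numerator.\<close>

lemma euler2:
  fixes x z :: "'a::{real_normed_field,banach}"
  assumes x: "norm x < 1"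
  shows "(\<lambda>n. x ^ (n choose 2) / qfact x n * z ^ n) sums (\<Prod>i. 1 + z * x ^ i)"
proof -
  define c where "c n = x ^ (n choose 2) / qfact x n" for n
  define G where "G y = (\<Sum>n. c n * y ^ n)" for y
  have summ: "summable (\<lambda>n. c n * y ^ n)" for y
    unfolding c_def by (rule summable_norm_cancel[OF summable_norm_euler2[OF x]])
  have step: "G y = (1 + y) * G (x * y)" for y
  proof -
    have "G y - G (x * y) = (\<Sum>n. c n * y ^ n - c n * (x * y) ^ n)"
      unfolding G_def by (rule suminf_diff[OF summ summ])
    also have "\<dots> = (\<Sum>n. c (Suc n) * y ^ Suc n - c (Suc n) * (x * y) ^ Suc n)"
      by (subst suminf_split_head[OF summable_diff[OF summ summ]]) simp
    also have "\<dots> = (\<Sum>n. y * (c n * (x * y) ^ n))"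
    proof (rule suminf_cong)
      fix n
      have "c (Suc n) * y ^ Suc n - c (Suc n) * (x * y) ^ Suc n
          = x ^ (n choose 2) * x ^ n * y ^ Suc n * (1 - x ^ Suc n) / qfact x (Suc n)"
        unfolding c_def Suc_choose_two power_add
        by (simp add: field_simps diff_divide_distrib)
      also have "\<dots> = y * (c n * (x * y) ^ n)"
        using one_minus_power_nonzero[OF x, of n]
        unfolding qfact_Suc c_def by (simp add: power_mult_distrib)
      finally show "c (Suc n) * y ^ Suc n - c (Suc n) * (x * y) ^ Suc n
          = y * (c n * (x * y) ^ n)" .
    qed
    also have "\<dots> = y * G (x * y)"
      unfolding G_def by (rule suminf_mult[OF summ])
    finally show ?thesis by (simp add: algebra_simps)
  qed
  have iter: "G z = (\<Prod>i<N. 1 + z * x ^ i) * G (x ^ N * z)" for N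
  proof (induction N)
    case (Suc N)
    have "G (x ^ N * z) = (1 + x ^ N * z) * G (x ^ Suc N * z)"
      using step[of "x ^ N * z"] by (simp add: mult.assoc)
    then show ?case using Suc by (simp add: mult_ac)
  qed simp
  have "(\<lambda>N. G (x ^ N * z)) \<longlonglongrightarrow> 1"
    unfolding G_def using powser_geometric_tendsto[OF x summ[of 1], of z]
    by (simp add: c_def numeral_2_eq_2)
  then have "(\<lambda>N. (\<Prod>i<N. 1 + z * x ^ i) * G (x ^ N * z)) \<longlonglongrightarrow> (\<Prod>i. 1 + z * x ^ i) * 1"
    by (intro tendsto_mult prod_one_plus_geometric_tendsto x)
  then have "G z = (\<Prod>i. 1 + z * x ^ i)"
    unfolding iter[symmetric] by (simp add: LIMSEQ_const_iff)
  then show ?thesis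
    using summable_sums[OF summ[of z]] by (simp add: G_def c_def)
qed

section \<open>Series split by the parity of the index\<close>

lemma sums_even_odd:
  fixes f g :: "nat \<Rightarrow> 'a::real_normed_vector"
  assumes g: "g sums x" and f: "f sums y"
  shows "(\<lambda>n. if even n then f (n div 2) else g ((n - 1) div 2)) sums (x + y)"
proof -
  let ?f = "\<lambda>n. if even n then f (n div 2) else 0"
  let ?g = "\<lambda>n. if odd n then g ((n - 1) div 2) else 0"
  \<comment> \<open>Each series is padded with zeros at the indices of the other parity, which keeps
    its sum; the interleaved series is then a termwise sum.\<close>
  have "(\<lambda>n. ?f (2 * n)) sums y \<longleftrightarrow> ?f sums y"
    by (rule sums_mono_reindex) (auto simp: strict_mono_def elim!: evenE)
  moreover have "(\<lambda>n. ?g (2 * n + 1)) sums x \<longleftrightarrow> ?g sums x"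
    by (rule sums_mono_reindex) (auto simp: strict_mono_def elim!: oddE)
  ultimately have "(\<lambda>n. ?g n + ?f n) sums (x + y)"
    using f g by (intro sums_add) simp_all
  moreover have "(\<lambda>n. ?g n + ?f n) = (\<lambda>n. if even n then f (n div 2) else g ((n - 1) div 2))"
    by auto
  ultimately show ?thesis by simp
qed

text \<open>The indices \<open>2 * s\<close> and \<open>2 * s + 1\<close> together give
  \<open>1 + u\<close> times Euler's first series at \<open>u\<^sup>2\<close>. The factor
  \<open>1 - u\<^sup>2\<close> of its product then cancels against \<open>1 + u\<close> and leaves
  \<open>1 - u\<close>. Absolute summability is recorded for the Cauchy product.\<close>

lemma euler1_doubled:
  fixes x u :: "'a::{real_normed_field,banach}"
  assumes x: "norm x < 1" and u: "norm u < 1"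
  shows "summable (\<lambda>r. norm (u ^ r / qfact x (r div 2)))"
    and "(\<lambda>r. u ^ r / qfact x (r div 2)) sums (1 / (1 - u) * (1 / (\<Prod>i. 1 - u\<^sup>2 * x * x ^ i)))"
proof -
  have u2: "norm (u\<^sup>2) < 1"
    using u by (simp add: norm_power power_less_one_iff)
  let ?f = "\<lambda>s. (u\<^sup>2) ^ s / qfact x s"
  have split: "u ^ r / qfact x (r div 2)
      = (if even r then ?f (r div 2) else u * ?f ((r - 1) div 2))" for r
    by (cases "even r") (auto elim!: evenE oddE simp: power_mult)
  have split_norm: "norm (u ^ r / qfact x (r div 2))
      = (if even r then norm (?f (r div 2)) else norm u * norm (?f ((r - 1) div 2)))" for r
    unfolding split by (cases "even r") (simp_all only: norm_mult if_True if_False)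
  have n: "summable (\<lambda>s. norm (?f s))"
    by (rule summable_norm_euler1[OF x u2])
  show "summable (\<lambda>r. norm (u ^ r / qfact x (r div 2)))"
    unfolding split_norm
    by (rule sums_summable[OF sums_even_odd[OF sums_mult[OF summable_sums[OF n]] summable_sums[OF n]]])
  have "(\<Prod>i. 1 - u\<^sup>2 * x ^ i) = (1 - u\<^sup>2) * (\<Prod>i. 1 - u\<^sup>2 * x * x ^ i)"
  proof -
    have "1 - u\<^sup>2 \<noteq> 0" using u2 by auto
    then show ?thesis
      using prodinf_split_head[OF convergent_prod_one_plus_geometric[OF x, of "- u\<^sup>2"]]
      by (simp add: field_simps)
  qed
  moreover have "1 - u\<^sup>2 = (1 - u) * (1 + u)"
    by (simp add: algebra_simps power2_eq_square)
  moreover have "1 - u \<noteq> 0" "1 + u \<noteq> 0"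
    using u by (auto simp: add_eq_0_iff)
  ultimately have val: "u * (1 / (\<Prod>i. 1 - u\<^sup>2 * x ^ i)) + 1 / (\<Prod>i. 1 - u\<^sup>2 * x ^ i)
      = 1 / (1 - u) * (1 / (\<Prod>i. 1 - u\<^sup>2 * x * x ^ i))"
    by (simp add: divide_simps)
  show "(\<lambda>r. u ^ r / qfact x (r div 2)) sums (1 / (1 - u) * (1 / (\<Prod>i. 1 - u\<^sup>2 * x * x ^ i)))"
    unfolding split val[symmetric]
    by (rule sums_even_odd[OF sums_mult[OF euler1[OF x u2]] euler1[OF x u2]])
qed

section \<open>Symplectic orders and exponents of \<open>q\<close>\<close>

lemma Sp_order_qfact:
  assumes "q > 1"
  shows "Sp_order (2 * m) q = q ^ (2 * m\<^sup>2 + m) * qfact (1 / q\<^sup>2) m"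
proof (induction m)
  case (Suc m)
  have 1: "Sp_order (2 * Suc m) q = Sp_order (2 * m) q * q ^ (2 * m + 1) * (q ^ (2 * Suc m) - 1)"
    by (simp add: Sp_order_def power2_eq_square power_add mult_2)
  have 2: "q ^ (2 * Suc m) - 1 = q ^ (2 * Suc m) * (1 - (1 / q\<^sup>2) ^ Suc m)"
    using assms by (simp add: right_diff_distrib power_divide flip: power_mult power_Suc)
  \<comment> \<open>The increment \<open>2 * m + 1\<close> comes from the prefactor
    \<open>q ^ (m\<^sup>2)\<close>, and \<open>2 * Suc m\<close> from pulling the power of
    \<open>q\<close> out of the new factor.\<close>
  have 3: "2 * (Suc m)\<^sup>2 + Suc m = (2 * m\<^sup>2 + m) + (2 * m + 1) + 2 * Suc m"
    by (simp add: power2_eq_square)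
  show ?case
    unfolding 1 2 3 Suc.IH qfact_Suc power_add by (simp only: mult_ac)
qed (simp add: Sp_order_def)

lemma two_mult_Suc_choose_two: "2 * (Suc k choose 2) = k * (k + 1)"
  by (induction k) (auto simp: Suc_choose_two)

context
  fixes q X :: real
  assumes q: "q > 1"
  defines "X \<equiv> 1 / q\<^sup>2"
begin

lemma power_X: "X ^ m = 1 / q ^ (2 * m)"
  by (simp add: X_def power_divide power_mult)

text \<open>Writing \<open>r = 2 * s\<close> and \<open>n = r + k\<close> removes truncated
  subtraction and halving. The exponent in \<open>A_r\<close> is
  \<open>n\<^sup>2 + 2 * s + k * (k + 1)\<close>: the first part cancels, the others become powers
  of \<open>X\<close>.\<close>

lemma A_r_even:
  "q ^ (2 * s + k)\<^sup>2 / A_r q (2 * s + k) (2 * s)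
    = X ^ s / qfact X s * (X ^ (Suc k choose 2) / qfact X k)"
proof -
  have exponents: "(2 * s) * (2 * s + 1) div 2 = s * (2 * s + 1)"
    "2 * (2 * s + k) - 2 * (2 * s) = 2 * k" by simp_all
  have "A_r q (2 * s + k) (2 * s)
      = q ^ (s * (2 * s + 1) + 2 * s * (2 * k) + (2 * s\<^sup>2 + s) + (2 * k\<^sup>2 + k)) * qfact X s * qfact X k"
    unfolding A_r_def exponents Sp_order_qfact[OF q] X_def power_add by (simp only: mult_ac)
  also have "s * (2 * s + 1) + 2 * s * (2 * k) + (2 * s\<^sup>2 + s) + (2 * k\<^sup>2 + k)
      = (2 * s + k)\<^sup>2 + 2 * s + 2 * (Suc k choose 2)"
    unfolding two_mult_Suc_choose_two by (simp add: power2_eq_square algebra_simps)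
  finally show ?thesis
    using q unfolding power_X by (simp add: power_add)
qed

text \<open>Here \<open>r = 2 * Suc s\<close>, since \<open>B_r\<close> starts at 2. The exponent is
  exactly \<open>n\<^sup>2 + k * (k + 1)\<close>, so no power of \<open>X\<close> depending on
  \<open>s\<close> remains, in contrast to \<open>A_r\<close>.\<close>

lemma B_r_even:
  "q ^ (2 * Suc s + k)\<^sup>2 / B_r q (2 * Suc s + k) (2 * Suc s)
    = 1 / qfact X s * (X ^ (Suc k choose 2) / qfact X k)"
proof -
  have exponents: "(2 * Suc s) * (2 * Suc s + 1) div 2 = Suc s * (2 * s + 3)"
    "2 * (2 * Suc s + k) - 2 * (2 * Suc s) = 2 * k"
    "2 * Suc s - 1 = 2 * s + 1" "2 * Suc s - 2 = 2 * s"
    by (simp_all add: algebra_simps)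
  have "B_r q (2 * Suc s + k) (2 * Suc s)
      = q ^ (Suc s * (2 * s + 3) + 2 * Suc s * (2 * k) + (2 * s + 1) + (2 * s\<^sup>2 + s) + (2 * k\<^sup>2 + k))
        * qfact X s * qfact X k"
    unfolding B_r_def exponents Sp_order_qfact[OF q] X_def power_add by (simp only: mult_ac)
  also have "Suc s * (2 * s + 3) + 2 * Suc s * (2 * k) + (2 * s + 1) + (2 * s\<^sup>2 + s) + (2 * k\<^sup>2 + k)
      = (2 * Suc s + k)\<^sup>2 + 2 * (Suc k choose 2)"
    unfolding two_mult_Suc_choose_two by (simp add: power2_eq_square algebra_simps)
  finally show ?thesis
    using q unfolding power_X by (simp add: power_add)
qed

lemma C_r_odd:
  "q ^ (2 * s + 1 + k)\<^sup>2 / C_r q (2 * s + 1 + k) (2 * s + 1)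
    = 1 / qfact X s * (X ^ (Suc k choose 2) / qfact X k)"
proof -
  \<comment> \<open>For odd \<open>r\<close> it is \<open>r + 1\<close> that absorbs the division by
    2.\<close>
  have "(2 * s + 1) * (2 * s + 1 + 1) = 2 * ((2 * s + 1) * (s + 1))"
    by (simp add: algebra_simps)
  then have exponents: "(2 * s + 1) * (2 * s + 1 + 1) div 2 = (2 * s + 1) * (s + 1)"
    "2 * (2 * s + 1 + k) - 2 * (2 * s + 1) = 2 * k" "2 * s + 1 - 1 = 2 * s"
    by (metis nonzero_mult_div_cancel_left zero_neq_numeral) simp_all
  have "C_r q (2 * s + 1 + k) (2 * s + 1)
      = q ^ ((2 * s + 1) * (s + 1) + (2 * s + 1) * (2 * k) + (2 * s\<^sup>2 + s) + (2 * k\<^sup>2 + k))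
        * qfact X s * qfact X k"
    unfolding C_r_def exponents Sp_order_qfact[OF q] X_def power_add by (simp only: mult_ac)
  also have "(2 * s + 1) * (s + 1) + (2 * s + 1) * (2 * k) + (2 * s\<^sup>2 + s) + (2 * k\<^sup>2 + k)
      = (2 * s + 1 + k)\<^sup>2 + 2 * (Suc k choose 2)"
    unfolding two_mult_Suc_choose_two by (simp add: power2_eq_square algebra_simps)
  finally show ?thesis
    using q unfolding power_X by (simp add: power_add)
qed

section \<open>Coefficients as convolutions\<close>

lemma norm_X: "norm X < 1"
  using q by (simp add: X_def)

lemma coefficient_summand:
  assumes "r \<le> n"
  shows "q ^ n\<^sup>2 * ((if even r then 1 / A_r q n r else 0) + (if even r \<and> r \<noteq> 0 then 1 / B_r q n r else 0)
      + (if odd r then 1 / C_r q n r else 0))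
    = 1 / qfact X (r div 2) * (X ^ (Suc (n - r) choose 2) / qfact X (n - r))"
proof -
  obtain k where n: "n = r + k" using assms le_Suc_ex by blast
  consider "r = 0" | s where "r = 2 * Suc s" | s where "r = 2 * s + 1"
    by (metis Suc_eq_plus1 evenE mult_0_right not0_implies_Suc oddE)
  then show ?thesis
  proof cases
    case 1
    then show ?thesis using A_r_even[of 0 k] by (simp add: n)
  next
    case 2
    \<comment> \<open>Over the common denominator \<open>qfact X (Suc s)\<close> the numerators are
      \<open>X ^ Suc s\<close> and \<open>1 - X ^ Suc s\<close>. For \<open>r = 0\<close> the
      \<open>B_r\<close> term is absent and \<open>A_r\<close> alone gives 1.\<close>
    have sum: "X ^ Suc s / qfact X (Suc s) + 1 / qfact X s = 1 / qfact X (Suc s)"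
      using qfact_nonzero[OF norm_X, of s] one_minus_power_nonzero[OF norm_X, of s]
      unfolding qfact_Suc by (simp add: divide_simps)
    have "c * (1 / a + 1 / b) = c / a + c / b" for a b c :: real
      by (simp add: distrib_left)
    then have "q ^ n\<^sup>2 * (1 / A_r q n r + 1 / B_r q n r)
        = 1 / qfact X (Suc s) * (X ^ (Suc k choose 2) / qfact X k)"
      by (simp only: n 2 A_r_even B_r_even distrib_right[symmetric] sum)
    moreover have "r div 2 = Suc s" "even r" "r \<noteq> 0" "n - r = k" using 2 n by auto
    ultimately show ?thesis by simp
  next
    case 3
    then show ?thesis using C_r_odd[of s k] by (simp add: n)
  qed
qed

text \<open>The three sums merge into one over \<open>r \<le> n\<close> with conditional summands.
  The lower bound 1 turns into \<open>r \<noteq> 0\<close> in the even case and is automatic for odd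
  \<open>r\<close>.\<close>

lemma coefficient_eq:
  "q ^ n\<^sup>2 * ((\<Sum>r | r \<in> {0..n} \<and> even r. 1 / A_r q n r)
      + (\<Sum>r | r \<in> {1..n} \<and> even r. 1 / B_r q n r)
      + (\<Sum>r | r \<in> {1..n} \<and> odd r. 1 / C_r q n r))
    = (\<Sum>r\<le>n. 1 / qfact X (r div 2) * (X ^ (Suc (n - r) choose 2) / qfact X (n - r)))"
  (is "?lhs = ?rhs")
proof -
  have "{r. r \<in> {0..n} \<and> even r} = {r \<in> {..n}. even r}"
    "{r. r \<in> {1..n} \<and> even r} = {r \<in> {..n}. even r \<and> r \<noteq> 0}"
    "{r. r \<in> {1..n} \<and> odd r} = {r \<in> {..n}. odd r}"
    by (auto elim: oddE)
  then have "?lhs = (\<Sum>r\<le>n. q ^ n\<^sup>2 * ((if even r then 1 / A_r q n r else 0)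
      + (if even r \<and> r \<noteq> 0 then 1 / B_r q n r else 0) + (if odd r then 1 / C_r q n r else 0)))"
    by (simp only: sum.inter_filter finite_atMost sum.distrib sum_distrib_left[symmetric])
  also have "\<dots> = ?rhs"
    by (intro sum.cong refl coefficient_summand) simp
  finally show ?thesis .
qed

end

section \<open>The generating function as a Cauchy product\<close>

theorem theorem2p10:
  fixes q :: real and u :: complex
  assumes "q > 1" and "norm u < 1"
  shows "convergent_prod (\<lambda>i. 1 + u / of_real (q ^ (2 * Suc i)))
    \<and> convergent_prod (\<lambda>i. 1 - u\<^sup>2 / of_real (q ^ (2 * Suc i)))
    \<and> (\<lambda>n. u ^ n * of_real (q ^ (n\<^sup>2)) * of_real (
          (\<Sum>r | r \<in> {0..n} \<and> even r. 1 / A_r q n r)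
        + (\<Sum>r | r \<in> {1..n} \<and> even r. 1 / B_r q n r)
        + (\<Sum>r | r \<in> {1..n} \<and> odd r. 1 / C_r q n r)))
      sums (1 / (1 - u) *
        ((\<Prod>i. 1 + u / of_real (q ^ (2 * Suc i))) / (\<Prod>i. 1 - u\<^sup>2 / of_real (q ^ (2 * Suc i)))))"
proof -
  define X where "X = 1 / q\<^sup>2"
  define x where "x = complex_of_real X"
  have x: "norm x < 1"
    using norm_X[OF assms(1)] by (simp only: x_def X_def norm_of_real real_norm_def)
  \<comment> \<open>The products of the theorem begin with exponent 1 of \<open>x\<close>, those of
    Euler with exponent 0; the surplus \<open>x\<close> is moved into the argument
    \<open>w * x\<close>.\<close>
  have geom: "w / of_real (q ^ (2 * Suc i)) = w * x * x ^ i" for w i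
  proof -
    have "X ^ Suc i = 1 / q ^ (2 * Suc i)"
      unfolding X_def by (rule power_X[OF assms(1)])
    then have "x ^ Suc i = 1 / of_real (q ^ (2 * Suc i))"
      unfolding x_def of_real_power[symmetric] by simp
    then show ?thesis by (simp add: mult.assoc)
  qed
  let ?a = "\<lambda>r. u ^ r / qfact x (r div 2)"
  \<comment> \<open>Splitting \<open>Suc k choose 2\<close> as \<open>(k choose 2) + k\<close> puts
    one \<open>x\<close> into each factor of the power, so Euler's second series is taken at
    \<open>u * x\<close>.\<close>
  let ?b = "\<lambda>k. x ^ (k choose 2) / qfact x k * (u * x) ^ k"
  have conv: "convergent_prod (\<lambda>i. 1 + w * x * x ^ i)" for w
    by (rule convergent_prod_one_plus_geometric[OF x])
  have "(\<lambda>n. \<Sum>r\<le>n. ?a r * ?b (n - r)) sums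
      (1 / (1 - u) * (1 / (\<Prod>i. 1 - u\<^sup>2 * x * x ^ i)) * (\<Prod>i. 1 + u * x * x ^ i))"
    using Cauchy_product_sums[OF euler1_doubled(1)[OF x assms(2)] summable_norm_euler2[OF x, of "u * x"]]
    by (simp only: sums_unique[OF euler1_doubled(2)[OF x assms(2)], symmetric]
        sums_unique[OF euler2[OF x, of "u * x"], symmetric])
  moreover have "(\<Sum>r\<le>n. ?a r * ?b (n - r))
      = u ^ n * of_real (q ^ (n\<^sup>2)) * of_real (
          (\<Sum>r | r \<in> {0..n} \<and> even r. 1 / A_r q n r)
        + (\<Sum>r | r \<in> {1..n} \<and> even r. 1 / B_r q n r)
        + (\<Sum>r | r \<in> {1..n} \<and> odd r. 1 / C_r q n r))" for n
  proof -
    have "?a r * ?b (n - r) = u ^ n * of_real (1 / qfact X (r div 2)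
        * (X ^ (Suc (n - r) choose 2) / qfact X (n - r)))" if "r \<le> n" for r
    proof -
      have "u ^ n = u ^ r * u ^ (n - r)" using that by (simp flip: power_add)
      then show ?thesis
        unfolding x_def qfact_of_real Suc_choose_two power_add
        by (simp add: power_mult_distrib)
    qed
    then have "(\<Sum>r\<le>n. ?a r * ?b (n - r)) = u ^ n * of_real (\<Sum>r\<le>n. 1 / qfact X (r div 2)
        * (X ^ (Suc (n - r) choose 2) / qfact X (n - r)))"
      by (simp add: sum_distrib_left)
    then show ?thesis
      unfolding X_def coefficient_eq[OF assms(1), symmetric] by (simp add: mult.assoc)
  qed
  ultimately show ?thesis
    unfolding geom using conv[of u] conv[of "- u\<^sup>2"] by simp
qed

end
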